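(* Let $p\ge1$ and let $R_p=\{A\in GL(2p,\mathbb K):\ {}^tA\,\Theta_p A=\Theta_p\}$, a Lie subgroup of $GL(2p,\mathbb K)$. The Lie algebra $\mathfrak r_p$ of the Lie group $R_p$ is the Lie subalgebra of $gl(2p,\mathbb K)$ given by $$\mathfrak r_p=\{A\in gl(2p,\mathbb K):\ {}^tA\,\Theta_p+\Theta_pA=0\}.$$
   Context: $\mathbb K$ is an algebraically closed field of characteristic $0$; Lie-group notions are understood over $\mathbb K$ (complex Lie groups when $\mathbb K=\mathbb C$; linear algebraic groups for general $\mathbb K$). $\Theta_p$ is the $2p\times 2p$ block-diagonal matrix with $p$ diagonal blocks all equal to $\begin{pmatrix}0&1\\-1&0\end{pmatrix}$. *)

theory Defs
  imports
    "Jordan_Normal_Form.Matrix"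
    "HOL-Library.Poly_Mapping"
    "HOL-Computational_Algebra.Fundamental_Theorem_Algebra"
    "HOL-Analysis.Complex_Analysis_Basics"
begin

definition GL :: "nat \<Rightarrow> 'k::field mat monoid" where
  "GL n = units_of (ring_mat TYPE('k) n ())"

definition Theta :: "nat \<Rightarrow> 'k::field mat" where
  "Theta p = diag_block_mat (replicate p (mat_of_rows_list 2 [[0, 1], [- 1, 0]]))"

definition Rgrp :: "nat \<Rightarrow> 'k::field mat set" where
  "Rgrp p = {A \<in> carrier (GL (2 * p)). transpose_mat A * Theta p * A = Theta p}"

definition ralg :: "nat \<Rightarrow> 'k::field mat set" where
  "ralg p = {A \<in> carrier_mat (2 * p) (2 * p).
     transpose_mat A * Theta p + Theta p * A = 0\<^sub>m (2 * p) (2 * p)}"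

text \<open>Lie subalgebras of \<open>gl(n)\<close>, whose bracket is the commutator.\<close>

definition lie_subalgebra :: "nat \<Rightarrow> 'k::field mat set \<Rightarrow> bool" where
  "lie_subalgebra n L \<longleftrightarrow>
     L \<subseteq> carrier_mat n n \<and> 0\<^sub>m n n \<in> L \<and>
     (\<forall>A\<in>L. \<forall>B\<in>L. A + B \<in> L) \<and>
     (\<forall>c. \<forall>A\<in>L. c \<cdot>\<^sub>m A \<in> L) \<and>
     (\<forall>A\<in>L. \<forall>B\<in>L. A * B - B * A \<in> L)"


section \<open>Linear algebraic groups and their Lie algebras\<close>

text \<open>
  Polynomials in the matrix entries. The variable \<open>(i, j)\<close> stands for the entry in row \<open>i\<close> and
  column \<open>j\<close>; a monomial is its finitely supported exponent vector.
\<close>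

type_synonym 'k entry_poly = "((nat \<times> nat) \<Rightarrow>\<^sub>0 nat) \<Rightarrow>\<^sub>0 'k"

text \<open>Restricting the variables matters: entries outside the matrix have unspecified values.\<close>

definition entry_polys :: "nat \<Rightarrow> 'k::field entry_poly set" where
  "entry_polys n = {f. \<forall>m \<in> Poly_Mapping.keys f. Poly_Mapping.keys m \<subseteq> {..<n} \<times> {..<n}}"

definition poly_at :: "'k::field entry_poly \<Rightarrow> 'k mat \<Rightarrow> 'k" where
  "poly_at f A = (\<Sum>m \<in> Poly_Mapping.keys f.
     Poly_Mapping.lookup f m * (\<Prod>v \<in> Poly_Mapping.keys m. (A $$ v) ^ Poly_Mapping.lookup m v))"

definition partial_poly :: "nat \<times> nat \<Rightarrow> 'k::field entry_poly \<Rightarrow> 'k entry_poly" where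
  "partial_poly v f = (\<Sum>m \<in> Poly_Mapping.keys f.
     Poly_Mapping.single (m - Poly_Mapping.single v 1)
       (of_nat (Poly_Mapping.lookup m v) * Poly_Mapping.lookup f m))"

definition linear_algebraic_subgroup :: "nat \<Rightarrow> 'k::field mat set \<Rightarrow> bool" where
  "linear_algebraic_subgroup n G \<longleftrightarrow>
     subgroup G (GL n) \<and>
     (\<exists>S \<subseteq> entry_polys n. G = {A \<in> carrier (GL n). \<forall>f\<in>S. poly_at f A = 0})"

text \<open>
  The Zariski tangent space at the identity, inside \<open>gl(n)\<close>: the common zeros of the differentials
  at the identity of \<^emph>\<open>all\<close> polynomials vanishing on \<open>G\<close>. Since \<open>GL(n)\<close> is a principal open subset
  of affine space, allowing powers of the inverse determinant would not change it.
\<close>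

definition algebraic_lie_algebra :: "nat \<Rightarrow> 'k::field mat set \<Rightarrow> 'k mat set" where
  "algebraic_lie_algebra n G = {X \<in> carrier_mat n n.
     \<forall>f \<in> entry_polys n. (\<forall>A\<in>G. poly_at f A = 0) \<longrightarrow>
       (\<Sum>v \<in> {..<n} \<times> {..<n}. poly_at (partial_poly v f) (1\<^sub>m n) * X $$ v) = 0}"


section \<open>Complex Lie groups and their Lie algebras\<close>

definition mat_dist :: "nat \<Rightarrow> complex mat \<Rightarrow> complex mat \<Rightarrow> real" where
  "mat_dist n A B = (\<Sum>v \<in> {..<n} \<times> {..<n}. norm (A $$ v - B $$ v))"

text \<open>
  Complex Frechet derivative at \<open>A\<close> of a function of \<open>n\<^sup>2\<close> variables; \<open>D $$ (i, j)\<close> is the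
  partial derivative in the direction of the entry \<open>(i, j)\<close>.
\<close>

definition has_mat_derivative ::
    "nat \<Rightarrow> (complex mat \<Rightarrow> complex) \<Rightarrow> complex mat \<Rightarrow> complex mat \<Rightarrow> bool" where
  "has_mat_derivative n F D A \<longleftrightarrow>
     (\<forall>\<epsilon>>0. \<exists>\<delta>>0. \<forall>B \<in> carrier_mat n n. mat_dist n B A < \<delta> \<longrightarrow>
        norm (F B - F A - (\<Sum>v \<in> {..<n} \<times> {..<n}. D $$ v * (B $$ v - A $$ v)))
          \<le> \<epsilon> * mat_dist n B A)"

text \<open>
  Embedded complex submanifolds of the space of \<open>n \<times> n\<close> matrices: locally the zero set of
  holomorphic functions \<open>F 0, \<dots>, F (m - 1)\<close> with linearly independent differentials, where \<open>m\<close>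
  is the codimension.
\<close>

definition complex_submanifold :: "nat \<Rightarrow> complex mat set \<Rightarrow> bool" where
  "complex_submanifold n M \<longleftrightarrow> M \<subseteq> carrier_mat n n \<and>
     (\<exists>m::nat. \<forall>A\<in>M. \<exists>r>0. \<exists>(F :: nat \<Rightarrow> complex mat \<Rightarrow> complex) D.
        (\<forall>B \<in> carrier_mat n n. mat_dist n B A < r \<longrightarrow>
           (B \<in> M \<longleftrightarrow> (\<forall>k<m. F k B = 0)) \<and>
           (\<forall>k<m. has_mat_derivative n (F k) (D k B) B)) \<and>
        (\<forall>c. \<exists>H \<in> carrier_mat n n. \<forall>k<m.
           (\<Sum>v \<in> {..<n} \<times> {..<n}. D k A $$ v * H $$ v) = c k))"

definition complex_lie_subgroup :: "nat \<Rightarrow> complex mat set \<Rightarrow> bool" where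
  "complex_lie_subgroup n G \<longleftrightarrow> subgroup G (GL n) \<and> complex_submanifold n G"

text \<open>
  The tangent space at the identity, inside \<open>gl(n)\<close>: velocities of holomorphic curves in \<open>G\<close>
  through the identity.
\<close>

definition complex_lie_algebra :: "nat \<Rightarrow> complex mat set \<Rightarrow> complex mat set" where
  "complex_lie_algebra n G = {X \<in> carrier_mat n n.
     \<exists>\<gamma> :: complex \<Rightarrow> complex mat. \<exists>e>0.
       \<gamma> 0 = 1\<^sub>m n \<and> (\<forall>t \<in> ball 0 e. \<gamma> t \<in> G) \<and>
       (\<forall>v \<in> {..<n} \<times> {..<n}. (\<lambda>t. \<gamma> t $$ v) holomorphic_on ball 0 e \<and>
          ((\<lambda>t. \<gamma> t $$ v) has_field_derivative X $$ v) (at 0))}"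

end

theory Submission
  imports Defs "Jordan_Normal_Form.Determinant"
begin

text \<open>
  Write \<open>\<Theta>\<close> for \<open>Theta p\<close>; it is skew-symmetric with \<open>\<Theta>\<^sup>2 = -1\<close>. At the identity, the linear
  term of \<open>A \<mapsto> A\<^sup>T \<Theta> A\<close> in the direction \<open>X\<close> is \<open>X\<^sup>T \<Theta> + \<Theta> X\<close>, so tangent vectors of the group
  satisfy the linear condition that defines \<open>ralg p\<close>. In the algebraic setting this
  differential is applied to the polynomial equations of the group, in the analytic one to a
  holomorphic curve.

  The converse inclusion rests on symplectic transvections. A matrix \<open>X\<close> lies in \<open>ralg p\<close> iff
  \<open>X = S \<Theta>\<close> with \<open>S\<close> symmetric, and symmetric matrices are sums of matrices \<open>c v v\<^sup>T\<close>
  (\<open>symmetric_mat_induct\<close>). For \<open>X = c v v\<^sup>T \<Theta>\<close> the whole line \<open>1 + t X\<close> lies in the group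
  (\<open>transvection_in_Rgrp\<close>), because \<open>v\<^sup>T \<Theta> v = 0\<close> kills the quadratic term. Hence such an \<open>X\<close>
  is tangent in both senses: a polynomial that vanishes on the group vanishes along the line,
  and the line is itself a holomorphic curve. Both tangent spaces are closed under addition --
  for curves one multiplies pointwise -- and so contain all of \<open>ralg p\<close>
  (\<open>ralg_transvection_induct\<close>). This replaces the matrix exponential, which has no meaning
  over a general field, and treats both settings by one induction.

  The group is a complex submanifold because \<open>A\<^sup>T \<Theta> A\<close> is always skew-symmetric: the entries
  above the diagonal give all equations, and at a point of the group the differential maps
  onto the skew-symmetric matrices, with an explicit right inverse
  (\<open>isometry_differential_surj\<close>).
\<close>

section \<open>The standard symplectic matrix\<close>

abbreviation Theta_block :: "'k::field mat" where
  "Theta_block \<equiv> mat_of_rows_list 2 [[0, 1], [- 1, 0]]"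

lemma Theta_block_carrier: "Theta_block \<in> carrier_mat 2 2"
  by (rule carrier_matI) (simp_all add: mat_of_rows_list_def)

lemma transpose_Theta_block: "transpose_mat Theta_block = - (Theta_block :: 'k::field mat)"
  by (rule eq_matI) (auto simp: mat_of_rows_list_def numeral_2_eq_2 less_Suc_eq)

lemma Theta_block_squared: "Theta_block * Theta_block = - (1\<^sub>m 2 :: 'k::field mat)"
  by (rule eq_matI)
    (auto simp: mat_of_rows_list_def scalar_prod_def numeral_2_eq_2 less_Suc_eq)

lemma Theta_carrier: "(Theta p :: 'k::field mat) \<in> carrier_mat (2 * p) (2 * p)"
proof (rule carrier_matI)
  have d: "dim_row M = 2" "dim_col M = 2" if "M = Theta_block" for M :: "'k mat"
    using Theta_block_carrier[where 'a = 'k] that by auto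
  show "dim_row (Theta p :: 'k mat) = 2 * p" "dim_col (Theta p :: 'k mat) = 2 * p"
    unfolding Theta_def dim_diag_block_mat map_replicate d[OF refl] by (simp_all add: sum_list_replicate)
qed

lemma Theta_dims [simp]: "dim_row (Theta p) = 2 * p" "dim_col (Theta p) = 2 * p"
  by (rule carrier_matD[OF Theta_carrier])+

lemma Theta_Suc:
  "Theta (Suc p) = four_block_mat Theta_block (0\<^sub>m 2 (2 * p)) (0\<^sub>m (2 * p) 2) (Theta p)"
  unfolding Theta_def replicate_Suc diag_block_mat.simps Let_def
    Theta_dims[unfolded Theta_def] carrier_matD[OF Theta_block_carrier] ..

lemma uminus_block_diagonal:
  fixes A :: "'k::ring_1 mat"
  assumes "A \<in> carrier_mat n n" "D \<in> carrier_mat m m"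
  shows "- four_block_mat A (0\<^sub>m n m) (0\<^sub>m m n) D = four_block_mat (- A) (0\<^sub>m n m) (0\<^sub>m m n) (- D)"
  by (rule eq_matI) (use assms in auto)

lemma transpose_block_diagonal:
  fixes A :: "'k::ring_1 mat"
  assumes "A \<in> carrier_mat n n" "D \<in> carrier_mat m m"
  shows "transpose_mat (four_block_mat A (0\<^sub>m n m) (0\<^sub>m m n) D)
    = four_block_mat (transpose_mat A) (0\<^sub>m n m) (0\<^sub>m m n) (transpose_mat D)"
  by (rule eq_matI) (use assms in auto)

lemma mult_block_diagonal:
  fixes A :: "'k::ring_1 mat"
  assumes A: "A \<in> carrier_mat n n" "B \<in> carrier_mat n n"
    and D: "D \<in> carrier_mat m m" "E \<in> carrier_mat m m"
  shows "four_block_mat A (0\<^sub>m n m) (0\<^sub>m m n) D * four_block_mat B (0\<^sub>m n m) (0\<^sub>m m n) E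
    = four_block_mat (A * B) (0\<^sub>m n m) (0\<^sub>m m n) (D * E)"
  using mult_four_block_mat[OF A(1) zero_carrier_mat zero_carrier_mat D(1) A(2) zero_carrier_mat zero_carrier_mat D(2)]
    A D by simp

lemma transpose_Theta: "transpose_mat (Theta p) = - (Theta p :: 'k::field mat)"
proof (induction p)
  case 0
  show ?case by (rule eq_matI) simp_all
next
  case (Suc p)
  show ?case
    unfolding Theta_Suc transpose_block_diagonal[OF Theta_block_carrier Theta_carrier]
      uminus_block_diagonal[OF Theta_block_carrier Theta_carrier] Suc.IH transpose_Theta_block ..
qed

lemma Theta_squared: "Theta p * Theta p = - (1\<^sub>m (2 * p) :: 'k::field mat)"
proof (induction p)
  case 0
  show ?case by (rule eq_matI) simp_all
next
  case (Suc p)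
  have "Theta (Suc p) * Theta (Suc p) =
      four_block_mat (- 1\<^sub>m 2) (0\<^sub>m 2 (2 * p)) (0\<^sub>m (2 * p) 2) (- (1\<^sub>m (2 * p) :: 'k mat))"
    unfolding Theta_Suc mult_block_diagonal[OF Theta_block_carrier Theta_block_carrier Theta_carrier Theta_carrier]
      Suc.IH Theta_block_squared ..
  also have "\<dots> = - 1\<^sub>m (2 * Suc p)"
    unfolding uminus_block_diagonal[OF one_carrier_mat one_carrier_mat, symmetric] by simp
  finally show ?case .
qed
section \<open>Bilinear forms\<close>

lemma index_mult_mat_sum:
  assumes "A \<in> carrier_mat m n" "B \<in> carrier_mat n r" "i < m" "j < r"
  shows "(A * B) $$ (i, j) = (\<Sum>k<n. A $$ (i, k) * B $$ (k, j))"
  using assms by (simp add: scalar_prod_def atLeast0LessThan)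

lemma index_form:
  fixes J :: "'k::comm_ring_1 mat"
  assumes "J \<in> carrier_mat n n" "A \<in> carrier_mat n n" "B \<in> carrier_mat n n" "i < n" "j < n"
  shows "(transpose_mat A * J * B) $$ (i, j) = (\<Sum>l<n. \<Sum>k<n. A $$ (k, i) * J $$ (k, l) * B $$ (l, j))"
  using assms by (simp add: scalar_prod_def atLeast0LessThan sum_distrib_right del: assoc_mult_mat)

text \<open>
  Second-order Taylor expansion of the quadratic map \<open>A \<mapsto> A\<^sup>T J A\<close> at \<open>A\<close>. The
  differentials of the equations of the group are read off from its linear term.
\<close>

lemma form_expand:
  fixes J :: "'k::comm_ring_1 mat"
  assumes "J \<in> carrier_mat n n" "A \<in> carrier_mat n n" "H \<in> carrier_mat n n"
  shows "transpose_mat (A + H) * J * (A + H) =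
    transpose_mat A * J * A + (transpose_mat H * J * A + transpose_mat A * J * H) + transpose_mat H * J * H"
    (is "_ = ?R")
proof -
  note c = assms assms[THEN transpose_carrier_mat[THEN iffD2]]
  have "transpose_mat (A + H) * J * (A + H) =
      (transpose_mat A * J + transpose_mat H * J) * (A + H)"
    using c by (simp add: transpose_add add_mult_distrib_mat)
  also have "\<dots> = (transpose_mat A * J + transpose_mat H * J) * A + (transpose_mat A * J + transpose_mat H * J) * H"
    using c by (intro mult_add_distrib_mat) auto
  also have "\<dots> = (transpose_mat A * J * A + transpose_mat H * J * A) +
      (transpose_mat A * J * H + transpose_mat H * J * H)"
    using c by (subst (1 2) add_mult_distrib_mat[where nr = n and nc = n and n = n]) auto
  also have "\<dots> = ?R"
    using c by (intro eq_matI) (simp_all del: assoc_mult_mat index_mult_mat(1))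
  finally show ?thesis .
qed

text \<open>
  For skew-symmetric \<open>J\<close>, exchanging the two arguments of the form costs a sign and a
  transposition. With \<open>A = B\<close>, the matrix \<open>A\<^sup>T J A\<close> is itself skew-symmetric.
\<close>

lemma transpose_form:
  fixes J :: "'k::comm_ring_1 mat"
  assumes J: "J \<in> carrier_mat n n" "transpose_mat J = - J"
    and AB: "A \<in> carrier_mat n m" "B \<in> carrier_mat n r"
  shows "transpose_mat (transpose_mat A * J * B) = - (transpose_mat B * J * A)"
proof -
  have "transpose_mat (transpose_mat A * J * B) = transpose_mat B * (transpose_mat J * A)"
    using J(1) AB by (subst transpose_mult[where n = n and nr = m and nc = r]) (auto simp: transpose_mult[where n = n])
  also have "\<dots> = - (transpose_mat B * J * A)"
    using assms by (simp add: assoc_mult_mat[where ?n\<^sub>1 = r and ?n\<^sub>2 = n and ?n\<^sub>3 = n and ?n\<^sub>4 = m])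
  finally show ?thesis .
qed

section \<open>The symplectic group\<close>

text \<open>
  As a rewrite rule, associativity needs the dimensions of all intermediate products; fixing
  them to one \<open>n\<close> lets the simplifier discharge these side conditions.
\<close>

lemma assoc_mult_square:
  fixes A :: "'k::semiring_0 mat"
  assumes "A \<in> carrier_mat n n" "B \<in> carrier_mat n n" "C \<in> carrier_mat n n"
  shows "A * B * C = A * (B * C)"
  using assms by (rule assoc_mult_mat)

lemma carrier_GL_iff:
  "A \<in> carrier (GL n) \<longleftrightarrow>
    A \<in> carrier_mat n n \<and> (\<exists>B\<in>carrier_mat n n. B * A = 1\<^sub>m n \<and> A * B = 1\<^sub>m n)"
  by (auto simp: GL_def units_of_def Units_def ring_mat_simps)

lemma mult_GL: "A \<otimes>\<^bsub>GL n\<^esub> B = A * B"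
  by (simp add: GL_def units_of_mult ring_mat_simps)

lemma one_GL: "\<one>\<^bsub>GL n\<^esub> = 1\<^sub>m n"
  by (simp add: GL_def units_of_one ring_mat_simps)

lemma group_GL: "group (GL n :: 'k::field mat monoid)"
proof -
  interpret ring "ring_mat TYPE('k) n ()" by (rule ring_mat)
  show ?thesis unfolding GL_def by (rule units_group)
qed

text \<open>
  Invertibility is automatic: from \<open>A\<^sup>T \<Theta> A = \<Theta>\<close> and \<open>\<Theta>\<^sup>2 = -1\<close> one reads off the left inverse
  \<open>- \<Theta> A\<^sup>T \<Theta>\<close>.
\<close>

lemma Rgrp_iff:
  "A \<in> Rgrp p \<longleftrightarrow> A \<in> carrier_mat (2 * p) (2 * p) \<and> transpose_mat A * Theta p * A = Theta p"
proof -
  note T = Theta_carrier[where 'k = 'a, of p]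
  note sq = assoc_mult_square[of _ "2 * p"]
    mult_carrier_mat[where nr = "2 * p" and n = "2 * p" and nc = "2 * p"]
  have "A \<in> carrier (GL (2 * p))"
    if A: "A \<in> carrier_mat (2 * p) (2 * p)" and eq: "transpose_mat A * Theta p * A = Theta p"
    for A :: "'a mat"
  proof -
    let ?B = "- (Theta p * transpose_mat A * Theta p)"
    have B: "?B \<in> carrier_mat (2 * p) (2 * p)"
      using A T by simp
    have "?B * A = - (Theta p * (transpose_mat A * Theta p * A))"
      using A T by (simp add: sq)
    also have "\<dots> = 1\<^sub>m (2 * p)"
      unfolding eq Theta_squared by simp
    finally have "?B * A = 1\<^sub>m (2 * p)" .
    with mat_mult_left_right_inverse[OF B A] A B show ?thesis
      unfolding carrier_GL_iff by blast
  qed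
  then show ?thesis
    by (auto simp: Rgrp_def carrier_GL_iff)
qed

lemma subgroup_Rgrp: "subgroup (Rgrp p) (GL (2 * p) :: 'k::field mat monoid)"
proof -
  note T = Theta_carrier[where 'k = 'k, of p]
  note sq = assoc_mult_square[of _ "2 * p"]
    mult_carrier_mat[where nr = "2 * p" and n = "2 * p" and nc = "2 * p"]
  let ?n = "2 * p"
  interpret group "GL ?n :: 'k mat monoid" by (rule group_GL)
  show ?thesis
  proof (rule subgroupI)
    show "Rgrp p \<subseteq> carrier (GL ?n)"
      by (auto simp: Rgrp_def)
    have "1\<^sub>m ?n \<in> (Rgrp p :: 'k mat set)"
      using T by (simp add: Rgrp_iff)
    then show "(Rgrp p :: 'k mat set) \<noteq> {}"
      by blast
  next
    fix A B :: "'k mat"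
    assume "A \<in> Rgrp p" "B \<in> Rgrp p"
    then have A: "A \<in> carrier_mat ?n ?n" "transpose_mat A * Theta p * A = Theta p"
      and B: "B \<in> carrier_mat ?n ?n" "transpose_mat B * Theta p * B = Theta p"
      by (auto simp: Rgrp_iff)
    have "transpose_mat (A * B) * Theta p * (A * B) = transpose_mat B * (transpose_mat A * Theta p * A) * B"
      using A(1) B(1) T by (simp add: transpose_mult sq)
    then show "A \<otimes>\<^bsub>GL ?n\<^esub> B \<in> Rgrp p"
      unfolding A(2) B(2) using A B T by (simp add: Rgrp_iff mult_GL)
  next
    fix A :: "'k mat"
    assume AR: "A \<in> Rgrp p"
    then have A: "A \<in> carrier_mat ?n ?n" "transpose_mat A * Theta p * A = Theta p"
      and G: "A \<in> carrier (GL ?n)"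
      by (auto simp: Rgrp_def carrier_GL_iff)
    define B where "B = inv\<^bsub>GL ?n\<^esub> A"
    have B: "B \<in> carrier_mat ?n ?n" and AB: "A * B = 1\<^sub>m ?n"
      using inv_closed[OF G] r_inv[OF G] unfolding B_def[symmetric] mult_GL one_GL carrier_GL_iff
      by auto
    have "transpose_mat B * Theta p * B = transpose_mat B * (transpose_mat A * Theta p * A) * B"
      unfolding A(2) ..
    also have "\<dots> = transpose_mat (A * B) * Theta p * (A * B)"
      using A(1) B T by (simp add: transpose_mult sq)
    also have "\<dots> = Theta p"
      unfolding AB by simp
    finally show "inv\<^bsub>GL ?n\<^esub> A \<in> Rgrp p"
      unfolding B_def[symmetric] using B T by (simp add: Rgrp_iff)
  qed
qed

lemma Rgrp_mult:
  assumes "A \<in> Rgrp p" "B \<in> Rgrp p"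
  shows "A * B \<in> Rgrp p"
  using subgroup.m_closed[OF subgroup_Rgrp assms] by (simp add: mult_GL)

section \<open>The symplectic Lie algebra\<close>

lemma ralg_iff:
  "A \<in> ralg p \<longleftrightarrow> A \<in> carrier_mat (2 * p) (2 * p) \<and>
     transpose_mat A * Theta p = - (Theta p * A :: 'k::field mat)"
proof -
  have "transpose_mat A * Theta p + Theta p * A = 0\<^sub>m (2 * p) (2 * p) \<longleftrightarrow>
      transpose_mat A * Theta p = - (Theta p * A)"
    if "A \<in> carrier_mat (2 * p) (2 * p)" for A :: "'k mat"
    using that by (auto simp: mat_eq_iff eq_neg_iff_add_eq_0 simp del: index_mult_mat(1))
  then show ?thesis
    by (auto simp: ralg_def)
qed

lemma lie_subalgebra_ralg: "lie_subalgebra (2 * p) (ralg p :: 'k::field mat set)"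
proof -
  note T = Theta_carrier[where 'k = 'k, of p]
  note sq = assoc_mult_square[of _ "2 * p"]
    mult_carrier_mat[where nr = "2 * p" and n = "2 * p" and nc = "2 * p"]
  let ?n = "2 * p"
  let ?T = "Theta p :: 'k mat"
  have *: "A \<in> carrier_mat ?n ?n" "transpose_mat A * ?T = - (?T * A)" if "A \<in> ralg p" for A :: "'k mat"
    using that T by (auto simp: ralg_iff)
  have bracket: "A * B - B * A \<in> ralg p" if "A \<in> ralg p" "B \<in> ralg p" for A B :: "'k mat"
  proof -
    note A = *[OF that(1)] and B = *[OF that(2)]
    have swap: "transpose_mat (A * B) * ?T = ?T * (B * A)"
      if A: "A \<in> carrier_mat ?n ?n" "transpose_mat A * ?T = - (?T * A)"
        and B: "B \<in> carrier_mat ?n ?n" "transpose_mat B * ?T = - (?T * B)" for A B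
    proof -
      have "transpose_mat (A * B) * ?T = transpose_mat B * (transpose_mat A * ?T)"
        using A(1) B(1) T by (simp add: transpose_mult sq)
      also have "\<dots> = - (transpose_mat B * ?T * A)"
        unfolding A(2) using A(1) B(1) T by simp
      also have "\<dots> = ?T * (B * A)"
        unfolding B(2) using A(1) B(1) T by simp
      finally show ?thesis .
    qed
    have c: "A * B \<in> carrier_mat ?n ?n" "B * A \<in> carrier_mat ?n ?n"
      using A B T by auto
    have "transpose_mat (A * B - B * A) * ?T =
        transpose_mat (A * B) * ?T - transpose_mat (B * A) * ?T"
      unfolding transpose_minus[OF c]
      by (rule minus_mult_distrib_mat[where nr = ?n and n = ?n and nc = ?n]) (use c T in auto)
    also have "\<dots> = ?T * (B * A) - ?T * (A * B)"
      unfolding swap[OF A B] swap[OF B A] ..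
    also have "\<dots> = - (?T * (A * B) - ?T * (B * A))"
      using A(1) B(1) T by (intro eq_matI) (simp_all del: index_mult_mat(1))
    also have "\<dots> = - (?T * (A * B - B * A))"
      using mult_minus_distrib_mat[OF Theta_carrier c, symmetric] T by simp
    finally show ?thesis
      using A(1) B(1) T by (auto simp: ralg_iff)
  qed
  have add: "A + B \<in> ralg p" if "A \<in> ralg p" "B \<in> ralg p" for A B :: "'k mat"
  proof -
    note A = *[OF that(1)] and B = *[OF that(2)]
    have "transpose_mat (A + B) * ?T = transpose_mat A * ?T + transpose_mat B * ?T"
      unfolding transpose_add[OF A(1) B(1)]
      by (rule add_mult_distrib_mat[where nr = ?n and n = ?n and nc = ?n]) (use A B T in auto)
    also have "\<dots> = - (?T * A + ?T * B)"
      unfolding A(2) B(2) using A(1) B(1) T by (intro eq_matI) (simp_all del: index_mult_mat(1))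
    also have "\<dots> = - (?T * (A + B))"
      using mult_add_distrib_mat[OF Theta_carrier A(1) B(1)] T by simp
    finally show ?thesis
      using A(1) B(1) T by (auto simp: ralg_iff)
  qed
  have smult: "c \<cdot>\<^sub>m A \<in> ralg p" if "A \<in> ralg p" for c and A :: "'k mat"
  proof -
    note A = *[OF that]
    have "transpose_mat (c \<cdot>\<^sub>m A) = c \<cdot>\<^sub>m transpose_mat A"
      by (rule eq_matI) auto
    then have "transpose_mat (c \<cdot>\<^sub>m A) * ?T = c \<cdot>\<^sub>m (transpose_mat A * ?T)"
      using mult_smult_assoc_mat[of "transpose_mat A" ?n ?n ?T ?n c] A(1) T by simp
    also have "\<dots> = - (c \<cdot>\<^sub>m (?T * A))"
      unfolding A(2) by (intro eq_matI) (simp_all del: index_mult_mat(1))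
    also have "\<dots> = - (?T * (c \<cdot>\<^sub>m A))"
      using mult_smult_distrib[OF Theta_carrier A(1)] T by simp
    finally show ?thesis
      using A(1) T by (auto simp: ralg_iff)
  qed
  have "0\<^sub>m ?n ?n \<in> (ralg p :: 'k mat set)"
    by (auto simp: ralg_def)
  with bracket add smult *(1) show ?thesis
    by (simp add: lie_subalgebra_def subset_iff)
qed

section \<open>Transvections span the Lie algebra\<close>

text \<open>
  Matrices of all sizes share one type, so no single zero matrix could start an indexed sum;
  the sum of a finite family is formed entry by entry instead.
\<close>

lemma closed_under_mat_sum:
  fixes F :: "'i \<Rightarrow> 'k::comm_monoid_add mat"
  assumes "finite I" "\<And>i. i \<in> I \<Longrightarrow> F i \<in> carrier_mat n n" "\<And>i. i \<in> I \<Longrightarrow> P (F i)"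
    and zero: "P (0\<^sub>m n n)"
    and add: "\<And>A B. A \<in> carrier_mat n n \<Longrightarrow> B \<in> carrier_mat n n \<Longrightarrow> P A \<Longrightarrow> P B \<Longrightarrow> P (A + B)"
  shows "P (Matrix.mat n n (\<lambda>v. \<Sum>i\<in>I. F i $$ v))"
  using assms(1-3)
proof (induction I rule: finite_induct)
  case empty
  have "Matrix.mat n n (\<lambda>v. \<Sum>i\<in>{}. F i $$ v) = 0\<^sub>m n n"
    by (rule eq_matI) auto
  then show ?case
    using zero by simp
next
  case (insert i I)
  have "Matrix.mat n n (\<lambda>v. \<Sum>i\<in>insert i I. F i $$ v) = F i + Matrix.mat n n (\<lambda>v. \<Sum>i\<in>I. F i $$ v)"
    using insert.hyps insert.prems(1)[of i] by (intro eq_matI) auto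
  then show ?case
    using insert add by auto
qed

text \<open>
  Polarization: \<open>x y\<^sup>T + y x\<^sup>T = (x + y) (x + y)\<^sup>T - x x\<^sup>T - y y\<^sup>T\<close>, applied to pairs of basis
  vectors, shows that squares \<open>v v\<^sup>T\<close> span the symmetric matrices. Vectors are represented as
  matrices with one column.
\<close>

lemma symmetric_mat_induct:
  fixes S :: "'k::field_char_0 mat"
  assumes S: "S \<in> carrier_mat n n" "transpose_mat S = S"
    and zero: "P (0\<^sub>m n n)"
    and add: "\<And>A B. A \<in> carrier_mat n n \<Longrightarrow> B \<in> carrier_mat n n \<Longrightarrow> P A \<Longrightarrow> P B \<Longrightarrow> P (A + B)"
    and outer: "\<And>c V. V \<in> carrier_mat n 1 \<Longrightarrow> P (c \<cdot>\<^sub>m (V * transpose_mat V))"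
  shows "P S"
proof -
  define W where "W = (\<lambda>f :: nat \<Rightarrow> 'k. Matrix.mat n 1 (\<lambda>(a, _). f a))"
  define e where "e = (\<lambda>(i::nat) (a::nat). if a = i then 1 else 0 :: 'k)"
  have delta2: "(\<Sum>i<n. \<Sum>j<n. g i j * (e i a * e j b)) = g a b"
    if "a < n" "b < n" for a b and g :: "nat \<Rightarrow> nat \<Rightarrow> 'k"
  proof -
    have "(\<Sum>j<n. g i j * (e i a * e j b)) = (if a = i then g i b else 0)" for i
      using that by (simp add: e_def if_distrib[of "\<lambda>x. _ * x"] cong: if_cong)
    then show ?thesis
      using that by simp
  qed
  define U where "U = (\<lambda>c f. c \<cdot>\<^sub>m (W f * transpose_mat (W f)))"
  have U: "U c f \<in> carrier_mat n n" "P (U c f)" for c f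
    by (auto simp: U_def W_def intro: outer)
  have U_index: "U c f $$ (a, b) = c * (f a * f b)" if "a < n" "b < n" for c f a b
    using that by (simp add: U_def W_def scalar_prod_def)
  \<comment> \<open>Polarization turns \<open>F (i, j)\<close> into \<open>c (e i e j\<^sup>T + e j e i\<^sup>T)\<close>; the half accounts for \<open>(i, j)\<close> and \<open>(j, i)\<close>.\<close>
  define F where "F = (\<lambda>(i, j). let c = S $$ (i, j) / 2 in
    U c (\<lambda>a. e i a + e j a) + (U (- c) (e i) + U (- c) (e j)))"
  have F: "F v \<in> carrier_mat n n" "P (F v)" for v
    by (auto simp: F_def Let_def split: prod.splits intro!: add U add_carrier_mat)
  have F_index: "F (i, j) $$ (a, b) = (S $$ (i, j) / 2) * (e i a * e j b + e j a * e i b)"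
    if "a < n" "b < n" for i j a b
    using that U(1) by (simp add: F_def Let_def U_index carrier_matD[OF U(1)] algebra_simps)
  have "P (Matrix.mat n n (\<lambda>v. \<Sum>w \<in> {..<n} \<times> {..<n}. F w $$ v))"
    by (rule closed_under_mat_sum) (use F zero add in auto)
  also have "Matrix.mat n n (\<lambda>v. \<Sum>w \<in> {..<n} \<times> {..<n}. F w $$ v) = S"
  proof (rule eq_matI)
    fix a b assume "a < dim_row S" "b < dim_col S"
    with S have ab: "a < n" "b < n"
      by auto
    have "(\<Sum>w \<in> {..<n} \<times> {..<n}. F w $$ (a, b)) =
        (\<Sum>i<n. \<Sum>j<n. (S $$ (i, j) / 2) * (e i a * e j b + e j a * e i b))"
      unfolding sum.cartesian_product by (rule sum.cong) (auto simp: F_index[OF ab])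
    also have "\<dots> = (\<Sum>i<n. \<Sum>j<n. S $$ (i, j) / 2 * (e i a * e j b)) +
        (\<Sum>j<n. \<Sum>i<n. S $$ (i, j) / 2 * (e j a * e i b))"
      unfolding distrib_left sum.distrib by (subst (4) sum.swap) (rule refl)
    also have "\<dots> = S $$ (a, b) / 2 + S $$ (b, a) / 2"
      by (simp only: delta2[OF ab])
    also have "S $$ (b, a) = S $$ (a, b)"
      using ab S by (metis carrier_matD index_transpose_mat(1))
    finally show "Matrix.mat n n (\<lambda>v. \<Sum>w \<in> {..<n} \<times> {..<n}. F w $$ v) $$ (a, b) = S $$ (a, b)"
      using ab by simp
  qed (use S in auto)
  finally show ?thesis .
qed

text \<open>
  The condition \<open>X\<^sup>T \<Theta> + \<Theta> X = 0\<close> says that \<open>\<Theta> X\<close> is symmetric; conjugating by \<open>\<Theta>\<close>, so is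
  \<open>S = - X \<Theta>\<close>, and \<open>S \<Theta> = - X \<Theta>\<^sup>2 = X\<close>.
\<close>

lemma ralg_symmetric_factor:
  fixes X :: "'k::field mat"
  assumes "X \<in> ralg p"
  obtains S where "S \<in> carrier_mat (2 * p) (2 * p)" "transpose_mat S = S" "X = S * Theta p"
proof
  note T = Theta_carrier[where 'k = 'k, of p]
  note sq = assoc_mult_square[of _ "2 * p"]
    mult_carrier_mat[where nr = "2 * p" and n = "2 * p" and nc = "2 * p"]
  let ?n = "2 * p"
  let ?T = "Theta p :: 'k mat"
  have X: "X \<in> carrier_mat ?n ?n" and eq: "transpose_mat X * ?T = - (?T * X)"
    using assms T by (auto simp: ralg_iff)
  have TT: "?T * (?T * A) = - A" if "A \<in> carrier_mat ?n ?n" for A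
    using assoc_mult_mat[OF Theta_carrier Theta_carrier that] that T by (simp add: Theta_squared del: assoc_mult_mat)
  show "- (X * ?T) \<in> carrier_mat ?n ?n"
    using X T by simp
  have "X = - (X * (?T * ?T))"
    using X T by (simp add: Theta_squared)
  also have "\<dots> = - (X * ?T) * ?T"
    using X T by simp
  finally show "X = - (X * ?T) * ?T" .
  have "transpose_mat X = - (transpose_mat X * (?T * ?T))"
    using X T by (simp add: Theta_squared)
  also have "\<dots> = - (transpose_mat X * ?T * ?T)"
    using X T by simp
  also have "\<dots> = ?T * X * ?T"
    unfolding eq using X T by simp
  finally have "?T * transpose_mat X = - (X * ?T)"
    using X T by (simp add: TT)
  then show "transpose_mat (- (X * ?T)) = - (X * ?T)"
    using X T by (simp add: transpose_uminus transpose_mult transpose_Theta)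
qed

lemma symmetric_mult_Theta_in_ralg:
  fixes S :: "'k::field mat"
  assumes S: "S \<in> carrier_mat (2 * p) (2 * p)" and sym: "transpose_mat S = S"
  shows "S * Theta p \<in> ralg p"
proof -
  note T = Theta_carrier[where 'k = 'k, of p]
  note sq = assoc_mult_square[of _ "2 * p"]
    mult_carrier_mat[where nr = "2 * p" and n = "2 * p" and nc = "2 * p"]
  have "transpose_mat (S * Theta p) = - (Theta p * S)"
    using S T by (simp add: transpose_mult[OF S T] transpose_Theta sym)
  then show ?thesis
    using S T by (simp add: ralg_iff sq)
qed

text \<open>
  The symplectic transvections. Put \<open>X = c v v\<^sup>T \<Theta>\<close>. The linear term of \<open>(1 + X)\<^sup>T \<Theta> (1 + X)\<close>
  vanishes because \<open>v v\<^sup>T\<close> is symmetric, and the quadratic term because \<open>v\<^sup>T \<Theta> v = 0\<close>. As \<open>c\<close>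
  is arbitrary, the whole affine line \<open>1 + t X\<close> lies in the group.
\<close>

lemma transvection_in_Rgrp:
  fixes V :: "'k::field_char_0 mat"
  assumes V: "V \<in> carrier_mat (2 * p) 1"
  shows "1\<^sub>m (2 * p) + c \<cdot>\<^sub>m (V * transpose_mat V) * Theta p \<in> Rgrp p"
proof -
  note T = Theta_carrier[where 'k = 'k, of p]
  note sq = assoc_mult_square[of _ "2 * p"]
    mult_carrier_mat[where nr = "2 * p" and n = "2 * p" and nc = "2 * p"]
  let ?n = "2 * p"
  let ?T = "Theta p :: 'k mat"
  let ?S = "c \<cdot>\<^sub>m (V * transpose_mat V)"
  let ?X = "?S * ?T"
  define w where "w = transpose_mat V * ?T * V"
  have X: "?X \<in> carrier_mat ?n ?n" and S: "?S \<in> carrier_mat ?n ?n"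
    using V T by auto
  have w: "w \<in> carrier_mat 1 1"
    unfolding w_def using V T by auto
  \<comment> \<open>The form is alternating: \<open>w\<close> is a \<open>1 \<times> 1\<close> matrix with \<open>w = w\<^sup>T = - w\<close>.\<close>
  have "transpose_mat w $$ (0, 0) = (- w) $$ (0, 0)"
    unfolding w_def using transpose_form[OF Theta_carrier transpose_Theta V V] by simp
  then have "w $$ (0, 0) = - w $$ (0, 0)"
    using w by simp
  then have w0: "w = 0\<^sub>m 1 1"
    using w by (intro eq_matI) auto
  have sym: "transpose_mat ?S = ?S"
    using V T by (intro eq_matI) (auto simp: scalar_prod_def)
  have lin: "transpose_mat ?X * ?T + ?T * ?X = 0\<^sub>m ?n ?n" and XT: "transpose_mat ?X * ?T = - (?T * ?X)"
    using symmetric_mult_Theta_in_ralg[OF S sym] by (simp add: ralg_def, simp add: ralg_iff)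
  have Vt: "transpose_mat V \<in> carrier_mat 1 ?n" and VtT: "transpose_mat V * ?T \<in> carrier_mat 1 ?n"
    and VVt: "V * transpose_mat V \<in> carrier_mat ?n ?n"
    using V T by auto
  have "V * transpose_mat V * ?T * (V * transpose_mat V) = V * (w * transpose_mat V)"
    unfolding w_def assoc_mult_mat[OF V Vt T] assoc_mult_mat[OF V VtT VVt] assoc_mult_mat[OF VtT V Vt] ..
  also have "\<dots> = 0\<^sub>m ?n ?n"
    unfolding w0 using V by simp
  finally have VV: "V * transpose_mat V * ?T * (V * transpose_mat V) = 0\<^sub>m ?n ?n" .
  have "?S * ?T * ?S = c \<cdot>\<^sub>m (c \<cdot>\<^sub>m (V * transpose_mat V * ?T * (V * transpose_mat V)))"
    unfolding mult_smult_assoc_mat[OF VVt T] mult_smult_assoc_mat[OF mult_carrier_mat[OF VVt T] S]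
      mult_smult_distrib[OF mult_carrier_mat[OF VVt T] VVt] ..
  then have STS: "?S * ?T * ?S = 0\<^sub>m ?n ?n"
    unfolding VV by simp
  have "transpose_mat ?X * ?T * ?X = - (?T * (?S * ?T * ?S) * ?T)"
    unfolding XT using S V T by (simp add: sq)
  also have "\<dots> = 0\<^sub>m ?n ?n"
    unfolding STS right_mult_zero_mat[OF T] left_mult_zero_mat[OF T] by (rule eq_matI) auto
  finally have "transpose_mat ?X * ?T * ?X = 0\<^sub>m ?n ?n" .
  then show ?thesis
    using form_expand[OF Theta_carrier one_carrier_mat X] lin X T by (simp add: Rgrp_iff del: assoc_mult_mat)
qed

text \<open>
  Both tangent spaces are closed under addition, so this reduces the inclusion of the whole
  Lie algebra to directions in which the group contains a line.
\<close>

lemma ralg_transvection_induct [consumes 1, case_names zero add transvection]: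
  fixes X :: "'k::field_char_0 mat"
  assumes "X \<in> ralg p"
    and zero: "P (0\<^sub>m (2 * p) (2 * p))"
    and add: "\<And>X Y. X \<in> carrier_mat (2 * p) (2 * p) \<Longrightarrow> Y \<in> carrier_mat (2 * p) (2 * p) \<Longrightarrow>
      P X \<Longrightarrow> P Y \<Longrightarrow> P (X + Y)"
    and transvection: "\<And>c V. V \<in> carrier_mat (2 * p) 1 \<Longrightarrow> P (c \<cdot>\<^sub>m (V * transpose_mat V) * Theta p)"
  shows "P X"
proof -
  note T = Theta_carrier[where 'k = 'k, of p]
  obtain S where S: "S \<in> carrier_mat (2 * p) (2 * p)" "transpose_mat S = S" and X: "X = S * Theta p"
    using assms(1) by (rule ralg_symmetric_factor)
  have "P (S * Theta p)"
  proof (rule symmetric_mat_induct[where P = "\<lambda>S. P (S * Theta p)", OF S])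
    show "P (0\<^sub>m (2 * p) (2 * p) * Theta p)"
      using zero by (simp add: left_mult_zero_mat[OF T])
  next
    fix A B :: "'k mat"
    assume AB: "A \<in> carrier_mat (2 * p) (2 * p)" "B \<in> carrier_mat (2 * p) (2 * p)"
      and "P (A * Theta p)" "P (B * Theta p)"
    with add[of "A * Theta p" "B * Theta p"] show "P ((A + B) * Theta p)"
      using T by (simp add: add_mult_distrib_mat[OF AB T])
  qed (rule transvection)
  then show ?thesis
    unfolding X .
qed

section \<open>Polynomials in the matrix entries\<close>

definition monomial_at :: "((nat \<times> nat) \<Rightarrow>\<^sub>0 nat) \<Rightarrow> 'k::field mat \<Rightarrow> 'k" where
  "monomial_at m A = (\<Prod>v \<in> Poly_Mapping.keys m. (A $$ v) ^ Poly_Mapping.lookup m v)"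

lemma monomial_at_superset:
  assumes "finite S" "Poly_Mapping.keys m \<subseteq> S"
  shows "monomial_at m A = (\<Prod>v\<in>S. (A $$ v) ^ Poly_Mapping.lookup m v)"
  unfolding monomial_at_def using assms
  by (intro prod.mono_neutral_left) (auto simp: in_keys_iff)

lemma monomial_at_0 [simp]: "monomial_at 0 A = 1"
  by (simp add: monomial_at_def)

lemma monomial_at_single [simp]: "monomial_at (Poly_Mapping.single v k) A = (A $$ v) ^ k"
  by (simp add: monomial_at_def)

lemma monomial_at_add: "monomial_at (m + m') A = monomial_at m A * monomial_at m' A"
proof -
  let ?S = "Poly_Mapping.keys m \<union> Poly_Mapping.keys m'"
  have "monomial_at (m + m') A = (\<Prod>v\<in>?S. (A $$ v) ^ Poly_Mapping.lookup (m + m') v)"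
    by (rule monomial_at_superset) (use keys_add[of m m'] in auto)
  also have "\<dots> = monomial_at m A * monomial_at m' A"
    by (subst (1 2) monomial_at_superset[of ?S]) (simp_all add: lookup_add power_add prod.distrib)
  finally show ?thesis .
qed

lemma poly_at_superset:
  assumes "finite S" "Poly_Mapping.keys f \<subseteq> S"
  shows "poly_at f A = (\<Sum>m\<in>S. Poly_Mapping.lookup f m * monomial_at m A)"
  unfolding poly_at_def monomial_at_def[symmetric] using assms
  by (intro sum.mono_neutral_left) (auto simp: in_keys_iff)

lemma poly_at_single [simp]: "poly_at (Poly_Mapping.single m c) A = c * monomial_at m A"
  by (simp add: poly_at_def monomial_at_def)

lemma poly_at_add: "poly_at (f + g) A = poly_at f A + poly_at g A"
proof -
  let ?S = "Poly_Mapping.keys f \<union> Poly_Mapping.keys g"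
  have "poly_at (f + g) A = (\<Sum>m\<in>?S. Poly_Mapping.lookup (f + g) m * monomial_at m A)"
    by (rule poly_at_superset) (use keys_add[of f g] in auto)
  also have "\<dots> = poly_at f A + poly_at g A"
    by (subst (1 2) poly_at_superset[of ?S]) (simp_all add: lookup_add distrib_right sum.distrib)
  finally show ?thesis .
qed

lemma poly_at_sum: "poly_at (\<Sum>i\<in>I. f i) A = (\<Sum>i\<in>I. poly_at (f i) A)"
proof (induction I rule: infinite_finite_induct)
  case (insert i I)
  then show ?case by (simp add: poly_at_add)
qed (simp_all add: poly_at_def)

lemma poly_at_partial_poly:
  "poly_at (partial_poly v f) A = (\<Sum>m \<in> Poly_Mapping.keys f. Poly_Mapping.lookup f m *
    (of_nat (Poly_Mapping.lookup m v) * monomial_at (m - Poly_Mapping.single v 1) A))"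
  by (simp add: partial_poly_def poly_at_sum mult_ac)

lemma pderiv_sum: "pderiv (\<Sum>i\<in>I. f i) = (\<Sum>i\<in>I. pderiv (f i))"
  by (induction I rule: infinite_finite_induct) (simp_all add: pderiv_add)

text \<open>
  The chain rule for a polynomial in the matrix entries, restricted to the line \<open>A + t X\<close>. The
  restriction may be given by any univariate polynomial with the right values, since over an
  infinite field the values determine the polynomial.
\<close>

lemma differential_along_line:
  fixes f :: "'k::field_char_0 entry_poly"
  assumes f: "f \<in> entry_polys n" and A: "A \<in> carrier_mat n n" and X: "X \<in> carrier_mat n n"
    and q: "\<And>t. poly q t = poly_at f (A + t \<cdot>\<^sub>m X)"
  shows "(\<Sum>v \<in> {..<n} \<times> {..<n}. poly_at (partial_poly v f) A * X $$ v) = poly (pderiv q) 0"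
proof -
  let ?I = "{..<n} \<times> {..<n}"
  let ?k = "Poly_Mapping.keys :: ((nat \<times> nat) \<Rightarrow>\<^sub>0 nat) \<Rightarrow> _"
  let ?l = "Poly_Mapping.lookup :: ((nat \<times> nat) \<Rightarrow>\<^sub>0 nat) \<Rightarrow> _"
  have km: "?k m \<subseteq> ?I" if "m \<in> Poly_Mapping.keys f" for m
    using f that by (auto simp: entry_polys_def)
  define Q where "Q = (\<Sum>m \<in> Poly_Mapping.keys f. smult (Poly_Mapping.lookup f m)
    (\<Prod>v \<in> ?k m. [:A $$ v, X $$ v:] ^ ?l m v))"
  have "poly Q t = poly_at f (A + t \<cdot>\<^sub>m X)" for t
  proof -
    have "(A + t \<cdot>\<^sub>m X) $$ v = A $$ v + t * X $$ v" if "v \<in> ?I" for v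
      using that A X by auto
    then have "poly (\<Prod>v \<in> ?k m. [:A $$ v, X $$ v:] ^ ?l m v) t =
        (\<Prod>v \<in> ?k m. (A + t \<cdot>\<^sub>m X) $$ v ^ ?l m v)" if "m \<in> Poly_Mapping.keys f" for m
      unfolding poly_prod poly_power using subsetD[OF km[OF that]] by (intro prod.cong) auto
    then show ?thesis
      unfolding Q_def poly_at_def poly_sum poly_smult by (intro sum.cong) auto
  qed
  then have "q = Q"
    using q by (simp add: poly_eq_poly_eq_iff[symmetric] fun_eq_iff)
  have mono: "monomial_at (m - Poly_Mapping.single v 1) A =
      (\<Prod>w \<in> ?k m - {v}. A $$ w ^ ?l m w) * A $$ v ^ (?l m v - 1)"
    if "v \<in> ?k m" for m v
  proof -
    have "monomial_at (m - Poly_Mapping.single v 1) A =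
        (\<Prod>w \<in> ?k m. A $$ w ^ ?l (m - Poly_Mapping.single v 1) w)"
      by (rule monomial_at_superset) (use keys_diff[of m "Poly_Mapping.single v 1"] that in auto)
    also have "\<dots> = A $$ v ^ (?l m v - 1) * (\<Prod>w \<in> ?k m - {v}. A $$ w ^ ?l m w)"
      using that by (subst prod.remove[of _ v])
        (auto simp: lookup_minus lookup_single when_def intro!: prod.cong)
    finally show ?thesis
      by (simp add: mult_ac)
  qed
  have "poly (pderiv Q) 0 = (\<Sum>m \<in> Poly_Mapping.keys f. Poly_Mapping.lookup f m *
      (\<Sum>v \<in> ?k m. of_nat (?l m v) * monomial_at (m - Poly_Mapping.single v 1) A * X $$ v))"
    unfolding Q_def pderiv_sum pderiv_smult pderiv_prod poly_sum poly_smult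
    by (intro sum.cong refl arg_cong2[where f = "(*)"])
      (simp add: mono[unfolded One_nat_def] poly_prod pderiv_power pderiv_pCons mult_ac)
  also have "\<dots> = (\<Sum>m \<in> Poly_Mapping.keys f. Poly_Mapping.lookup f m *
      (\<Sum>v \<in> ?I. of_nat (?l m v) * monomial_at (m - Poly_Mapping.single v 1) A * X $$ v))"
    by (intro sum.cong refl arg_cong2[where f = "(*)"] sum.mono_neutral_left)
      (use km in \<open>auto simp: in_keys_iff\<close>)
  also have "\<dots> = (\<Sum>v \<in> ?I. poly_at (partial_poly v f) A * X $$ v)"
    unfolding poly_at_partial_poly sum_distrib_left sum_distrib_right
    by (subst sum.swap) (simp add: mult_ac)
  finally show ?thesis
    unfolding \<open>q = Q\<close> by simp
qed

section \<open>The Zariski tangent space of the symplectic group\<close>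

definition isometry_poly :: "nat \<Rightarrow> nat \<Rightarrow> nat \<Rightarrow> 'k::field entry_poly" where
  "isometry_poly p i j =
     (\<Sum>l<2 * p. \<Sum>k<2 * p. Poly_Mapping.single
       (Poly_Mapping.single (k, i) 1 + Poly_Mapping.single (l, j) 1) (Theta p $$ (k, l)))
     + Poly_Mapping.single 0 (- (Theta p $$ (i, j)))"

lemma entry_polys_add: "f \<in> entry_polys n \<Longrightarrow> g \<in> entry_polys n \<Longrightarrow> f + g \<in> entry_polys n"
  using keys_add[of f g] by (fastforce simp: entry_polys_def)

lemma entry_polys_sum: "(\<And>i. i \<in> I \<Longrightarrow> f i \<in> entry_polys n) \<Longrightarrow> (\<Sum>i\<in>I. f i) \<in> entry_polys n"
proof (induction I rule: infinite_finite_induct)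
  case (insert i I)
  then show ?case by (simp add: entry_polys_add)
qed (simp_all add: entry_polys_def)

lemma entry_polys_single:
  "Poly_Mapping.keys m \<subseteq> {..<n} \<times> {..<n} \<Longrightarrow> Poly_Mapping.single m c \<in> entry_polys n"
  by (auto simp: entry_polys_def split: if_splits)

lemma isometry_poly_in_entry_polys:
  assumes "i < 2 * p" "j < 2 * p"
  shows "isometry_poly p i j \<in> entry_polys (2 * p)"
proof -
  have "Poly_Mapping.keys (Poly_Mapping.single (k, i) (1::nat) + Poly_Mapping.single (l, j) 1)
      \<subseteq> {..<2 * p} \<times> {..<2 * p}" if "k < 2 * p" "l < 2 * p" for k l
    using assms that keys_add[of "Poly_Mapping.single (k, i) (1::nat)" "Poly_Mapping.single (l, j) 1"]
    by auto
  then show ?thesis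
    unfolding isometry_poly_def
    by (intro entry_polys_add entry_polys_sum entry_polys_single) auto
qed

lemma poly_at_isometry_poly:
  assumes "A \<in> carrier_mat (2 * p) (2 * p)" "i < 2 * p" "j < 2 * p"
  shows "poly_at (isometry_poly p i j) A = (transpose_mat A * Theta p * A) $$ (i, j) - Theta p $$ (i, j)"
  unfolding isometry_poly_def index_form[OF Theta_carrier assms(1) assms]
  by (simp add: poly_at_add poly_at_sum monomial_at_add mult_ac)

lemma linear_algebraic_subgroup_Rgrp:
  "linear_algebraic_subgroup (2 * p) (Rgrp p :: 'k::field mat set)"
proof -
  let ?n = "2 * p"
  let ?S = "{isometry_poly p i j :: 'k entry_poly | i j. i < ?n \<and> j < ?n}"
  have "A \<in> Rgrp p \<longleftrightarrow> A \<in> carrier (GL ?n) \<and> (\<forall>f\<in>?S. poly_at f A = 0)" for A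
  proof (cases "A \<in> carrier (GL ?n)")
    case True
    then have A: "A \<in> carrier_mat ?n ?n"
      by (simp add: carrier_GL_iff)
    have "A \<in> Rgrp p \<longleftrightarrow> transpose_mat A * Theta p * A = Theta p"
      using A by (simp add: Rgrp_iff del: assoc_mult_mat)
    also have "\<dots> \<longleftrightarrow> (\<forall>i<?n. \<forall>j<?n. (transpose_mat A * Theta p * A) $$ (i, j) = Theta p $$ (i, j))"
      using A by (simp add: mat_eq_iff del: assoc_mult_mat index_mult_mat(1))
    also have "\<dots> \<longleftrightarrow> (\<forall>i<?n. \<forall>j<?n. poly_at (isometry_poly p i j) A = 0)"
      using A by (simp add: poly_at_isometry_poly del: assoc_mult_mat index_mult_mat(1))
    finally show ?thesis
      using True by blast
  qed (auto simp: Rgrp_def)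
  then have "Rgrp p = {A \<in> carrier (GL ?n). \<forall>f\<in>?S. poly_at f A = 0}"
    by blast
  moreover have "?S \<subseteq> entry_polys ?n"
    using isometry_poly_in_entry_polys by blast
  ultimately show ?thesis
    unfolding linear_algebraic_subgroup_def using subgroup_Rgrp by blast
qed

lemma smult_transvection:
  fixes M :: "'k::comm_ring_1 mat"
  assumes "M \<in> carrier_mat n n" "J \<in> carrier_mat n n"
  shows "t \<cdot>\<^sub>m (c \<cdot>\<^sub>m M * J) = (t * c) \<cdot>\<^sub>m M * J"
  using assms by (intro eq_matI)
    (auto simp: mult_smult_assoc_mat[where nr = n and n = n and nc = n] mult.assoc simp del: index_mult_mat(1))

text \<open>
  A tangent vector \<open>X\<close> is killed by the differentials of the defining equations, whose values at
  \<open>X\<close> are the entries of \<open>X\<^sup>T \<Theta> + \<Theta> X\<close>. Conversely, a polynomial that vanishes on the group vanishes along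
  each line of transvections, so its differential kills the direction of that line; these
  directions span.
\<close>

lemma algebraic_lie_algebra_Rgrp:
  "algebraic_lie_algebra (2 * p) (Rgrp p) = (ralg p :: 'k::field_char_0 mat set)"
proof (intro equalityI subsetI)
  let ?n = "2 * p"
  let ?T = "Theta p :: 'k mat"
  fix X :: "'k mat"
  assume "X \<in> algebraic_lie_algebra ?n (Rgrp p)"
  then have X: "X \<in> carrier_mat ?n ?n"
    and tangent: "\<And>f. f \<in> entry_polys ?n \<Longrightarrow> (\<And>A. A \<in> Rgrp p \<Longrightarrow> poly_at f A = 0) \<Longrightarrow>
      (\<Sum>v \<in> {..<?n} \<times> {..<?n}. poly_at (partial_poly v f) (1\<^sub>m ?n) * X $$ v) = 0"
    by (auto simp: algebraic_lie_algebra_def)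
  have "(transpose_mat X * ?T + ?T * X) $$ (i, j) = 0" if ij: "i < ?n" "j < ?n" for i j
  proof -
    let ?f = "isometry_poly p i j :: 'k entry_poly"
    \<comment> \<open>The restriction of the equation to the line \<open>1 + t X\<close> has no constant term since \<open>1\<close> is in the group.\<close>
    let ?q = "[:0, (transpose_mat X * ?T + ?T * X) $$ (i, j), (transpose_mat X * ?T * X) $$ (i, j):]"
    have q: "poly ?q t = poly_at ?f (1\<^sub>m ?n + t \<cdot>\<^sub>m X)" for t
    proof -
      have c: "t \<cdot>\<^sub>m X \<in> carrier_mat ?n ?n" "1\<^sub>m ?n + t \<cdot>\<^sub>m X \<in> carrier_mat ?n ?n"
        using X by auto
      have "transpose_mat (t \<cdot>\<^sub>m X) = t \<cdot>\<^sub>m transpose_mat X"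
        by (rule eq_matI) auto
      then show ?thesis
        unfolding poly_at_isometry_poly[OF c(2) ij] form_expand[OF Theta_carrier one_carrier_mat c(1)]
        using X ij Theta_carrier[of p, where 'k = 'k]
        by (simp add: mult_smult_assoc_mat[where nr = ?n and n = ?n and nc = ?n]
          mult_smult_distrib[where nr = ?n and n = ?n and nc = ?n]
          mult_carrier_mat[where nr = ?n and n = ?n and nc = ?n] algebra_simps
          del: index_mult_mat(1) assoc_mult_mat)
    qed
    have "poly_at ?f A = 0" if "A \<in> Rgrp p" for A
      using that ij by (simp add: Rgrp_iff poly_at_isometry_poly del: assoc_mult_mat)
    from tangent[OF isometry_poly_in_entry_polys[OF ij] this]
    show ?thesis
      unfolding differential_along_line[OF isometry_poly_in_entry_polys[OF ij] one_carrier_mat X q]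
      by (simp add: pderiv_pCons)
  qed
  with X show "X \<in> ralg p"
    by (auto simp: ralg_def mat_eq_iff simp del: index_mult_mat(1) index_add_mat(1))
next
  let ?n = "2 * p"
  let ?I = "{..<?n} \<times> {..<?n}"
  note T = Theta_carrier[of p, where 'k = 'k]
  fix X :: "'k mat"
  assume ralg: "X \<in> ralg p"
  have "(\<Sum>v \<in> ?I. poly_at (partial_poly v f) (1\<^sub>m ?n) * X $$ v) = 0"
    if f: "f \<in> entry_polys ?n" and vanish: "\<And>A. A \<in> Rgrp p \<Longrightarrow> poly_at f A = 0" for f
    using ralg
  proof (induction rule: ralg_transvection_induct)
    case zero
    show ?case by (rule sum.neutral) auto
  next
    case (add X Y)
    have "(\<Sum>v \<in> ?I. poly_at (partial_poly v f) (1\<^sub>m ?n) * (X + Y) $$ v) =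
        (\<Sum>v \<in> ?I. poly_at (partial_poly v f) (1\<^sub>m ?n) * X $$ v) +
        (\<Sum>v \<in> ?I. poly_at (partial_poly v f) (1\<^sub>m ?n) * Y $$ v)"
      unfolding sum.distrib[symmetric] using add(1,2) by (intro sum.cong) (auto simp: distrib_left)
    then show ?case
      using add by simp
  next
    case (transvection c V)
    let ?X = "c \<cdot>\<^sub>m (V * transpose_mat V) * Theta p"
    have X: "?X \<in> carrier_mat ?n ?n" and VV: "V * transpose_mat V \<in> carrier_mat ?n ?n"
      using transvection T by auto
    have "poly 0 t = poly_at f (1\<^sub>m ?n + t \<cdot>\<^sub>m ?X)" for t
      using vanish[OF transvection_in_Rgrp[OF transvection, of "t * c"]]
      by (simp add: smult_transvection[OF VV T])
    from differential_along_line[OF f one_carrier_mat X this] show ?case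
      by simp
  qed
  with ralg show "X \<in> algebraic_lie_algebra ?n (Rgrp p)"
    by (auto simp: algebraic_lie_algebra_def ralg_iff)
qed

section \<open>Velocities of holomorphic curves in the symplectic group\<close>

text \<open>
  The pointwise product of two curves through the identity has the sum of their velocities.
\<close>

lemma complex_lie_algebra_add:
  assumes G: "G \<subseteq> carrier_mat n n" and mult: "\<And>A B. A \<in> G \<Longrightarrow> B \<in> G \<Longrightarrow> A * B \<in> G"
    and X: "X \<in> complex_lie_algebra n G" and Y: "Y \<in> complex_lie_algebra n G"
  shows "X + Y \<in> complex_lie_algebra n G"
proof -
  let ?I = "{..<n} \<times> {..<n}"
  obtain \<gamma> e where \<gamma>: "e > 0" "\<gamma> 0 = 1\<^sub>m n" "\<And>t. t \<in> ball 0 e \<Longrightarrow> \<gamma> t \<in> G"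
    "\<And>v. v \<in> ?I \<Longrightarrow> (\<lambda>t. \<gamma> t $$ v) holomorphic_on ball 0 e"
    "\<And>v. v \<in> ?I \<Longrightarrow> ((\<lambda>t. \<gamma> t $$ v) has_field_derivative X $$ v) (at 0)"
    using X unfolding complex_lie_algebra_def by blast
  obtain \<eta> d where \<eta>: "d > 0" "\<eta> 0 = 1\<^sub>m n" "\<And>t. t \<in> ball 0 d \<Longrightarrow> \<eta> t \<in> G"
    "\<And>v. v \<in> ?I \<Longrightarrow> (\<lambda>t. \<eta> t $$ v) holomorphic_on ball 0 d"
    "\<And>v. v \<in> ?I \<Longrightarrow> ((\<lambda>t. \<eta> t $$ v) has_field_derivative Y $$ v) (at 0)"
    using Y unfolding complex_lie_algebra_def by blast
  have XY: "X \<in> carrier_mat n n" "Y \<in> carrier_mat n n"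
    using X Y by (auto simp: complex_lie_algebra_def)
  define r where "r = min e d"
  have r: "r > 0" and ball: "ball 0 r \<subseteq> ball (0::complex) e" "ball 0 r \<subseteq> ball (0::complex) d"
    using \<gamma>(1) \<eta>(1) by (auto simp: r_def)
  have entry: "(\<gamma> t * \<eta> t) $$ (i, j) = (\<Sum>k<n. \<gamma> t $$ (i, k) * \<eta> t $$ (k, j))"
    if "t \<in> ball 0 r" "i < n" "j < n" for t i j
  proof -
    have "\<gamma> t \<in> carrier_mat n n" "\<eta> t \<in> carrier_mat n n"
      using that(1) ball \<gamma>(3) \<eta>(3) G by blast+
    then show ?thesis
      using that(2,3) by (rule index_mult_mat_sum)
  qed
  have "(\<lambda>t. (\<gamma> t * \<eta> t) $$ (i, j)) holomorphic_on ball 0 r \<and>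
      ((\<lambda>t. (\<gamma> t * \<eta> t) $$ (i, j)) has_field_derivative (X + Y) $$ (i, j)) (at 0)"
    if ij: "i < n" "j < n" for i j
  proof
    have "(\<lambda>t. \<Sum>k<n. \<gamma> t $$ (i, k) * \<eta> t $$ (k, j)) holomorphic_on ball 0 r"
      using ij ball by (intro holomorphic_intros holomorphic_on_subset[OF \<gamma>(4)] holomorphic_on_subset[OF \<eta>(4)]) auto
    then show "(\<lambda>t. (\<gamma> t * \<eta> t) $$ (i, j)) holomorphic_on ball 0 r"
      by (rule holomorphic_transform) (simp only: entry[OF _ ij])
    have "((\<lambda>t. \<Sum>k<n. \<gamma> t $$ (i, k) * \<eta> t $$ (k, j)) has_field_derivative
        (\<Sum>k<n. X $$ (i, k) * \<eta> 0 $$ (k, j) + Y $$ (k, j) * \<gamma> 0 $$ (i, k))) (at 0)"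
      using ij by (intro DERIV_sum DERIV_mult \<gamma>(5) \<eta>(5)) auto
    also have "(\<Sum>k<n. X $$ (i, k) * \<eta> 0 $$ (k, j) + Y $$ (k, j) * \<gamma> 0 $$ (i, k)) =
        (\<Sum>k<n. (if k = j then X $$ (i, k) else 0) + (if i = k then Y $$ (k, j) else 0))"
      using ij by (intro sum.cong) (auto simp: \<gamma>(2) \<eta>(2))
    also have "\<dots> = (X + Y) $$ (i, j)"
      using ij XY by (simp add: sum.distrib)
    finally show "((\<lambda>t. (\<gamma> t * \<eta> t) $$ (i, j)) has_field_derivative (X + Y) $$ (i, j)) (at 0)"
      by (rule has_field_derivative_transform_within_open[OF _ open_ball[of 0 r]])
        (use r entry[OF _ ij] in auto)
  qed
  then have "(\<forall>v \<in> ?I. (\<lambda>t. (\<gamma> t * \<eta> t) $$ v) holomorphic_on ball 0 r \<and>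
      ((\<lambda>t. (\<gamma> t * \<eta> t) $$ v) has_field_derivative (X + Y) $$ v) (at 0))"
    by blast
  moreover have "\<gamma> 0 * \<eta> 0 = 1\<^sub>m n"
    using \<gamma>(2) \<eta>(2) by simp
  moreover have "\<forall>t \<in> ball 0 r. \<gamma> t * \<eta> t \<in> G"
    using ball \<gamma>(3) \<eta>(3) mult by blast
  ultimately show ?thesis
    using XY r unfolding complex_lie_algebra_def
    by (auto intro!: exI[of _ "\<lambda>t. \<gamma> t * \<eta> t"] exI[of _ r])
qed

lemma complex_lie_algebra_line:
  assumes X: "X \<in> carrier_mat n n" and line: "\<And>t. 1\<^sub>m n + t \<cdot>\<^sub>m X \<in> G"
  shows "X \<in> complex_lie_algebra n G"
proof -
  have "(\<lambda>t. (1\<^sub>m n + t \<cdot>\<^sub>m X) $$ (i, j)) = (\<lambda>t. 1\<^sub>m n $$ (i, j) + t * X $$ (i, j))"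
    if "i < n" "j < n" for i j
    using that X by auto
  then have "(\<lambda>t. (1\<^sub>m n + t \<cdot>\<^sub>m X) $$ v) holomorphic_on ball 0 1 \<and>
      ((\<lambda>t. (1\<^sub>m n + t \<cdot>\<^sub>m X) $$ v) has_field_derivative X $$ v) (at 0)"
    if "v \<in> {..<n} \<times> {..<n}" for v
    using that by (auto intro!: holomorphic_intros derivative_eq_intros simp del: index_one_mat)
  moreover have "1\<^sub>m n + 0 \<cdot>\<^sub>m X = 1\<^sub>m n"
    using X by (intro eq_matI) auto
  ultimately show ?thesis
    using X line unfolding complex_lie_algebra_def
    by (auto intro!: exI[of _ "\<lambda>t. 1\<^sub>m n + t \<cdot>\<^sub>m X"] exI[of _ "1::real"])
qed

text \<open>
  Differentiating \<open>\<gamma>(t)\<^sup>T \<Theta> \<gamma>(t) = \<Theta>\<close> at \<open>0\<close> gives the linear condition on the velocity.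
  Conversely, products of lines of transvections are polynomial curves whose velocities
  exhaust the Lie algebra.
\<close>

lemma complex_lie_algebra_Rgrp: "complex_lie_algebra (2 * p) (Rgrp p) = ralg p"
proof (intro equalityI subsetI)
  let ?n = "2 * p"
  let ?T = "Theta p :: complex mat"
  note T = Theta_carrier[of p, where 'k = complex]
  fix X
  assume "X \<in> complex_lie_algebra ?n (Rgrp p)"
  then obtain \<gamma> e where X: "X \<in> carrier_mat ?n ?n" and \<gamma>: "e > 0" "\<gamma> 0 = 1\<^sub>m ?n"
    "\<And>t. t \<in> ball 0 e \<Longrightarrow> \<gamma> t \<in> Rgrp p"
    "\<And>i j. i < ?n \<Longrightarrow> j < ?n \<Longrightarrow> ((\<lambda>t. \<gamma> t $$ (i, j)) has_field_derivative X $$ (i, j)) (at 0)"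
    unfolding complex_lie_algebra_def by blast
  have "(transpose_mat X * ?T + ?T * X) $$ (i, j) = 0" if ij: "i < ?n" "j < ?n" for i j
  proof -
    let ?f = "\<lambda>t. \<Sum>l<?n. \<Sum>k<?n. \<gamma> t $$ (k, i) * ?T $$ (k, l) * \<gamma> t $$ (l, j)"
    have const: "?f t = ?T $$ (i, j)" if t: "t \<in> ball 0 e" for t
    proof -
      have \<gamma>t: "\<gamma> t \<in> carrier_mat ?n ?n" "transpose_mat (\<gamma> t) * ?T * \<gamma> t = ?T"
        using \<gamma>(3)[OF t] by (auto simp: Rgrp_iff)
      show ?thesis
        unfolding index_form[OF T \<gamma>t(1) \<gamma>t(1) ij, symmetric] \<gamma>t(2) ..
    qed
    have "(?f has_field_derivative 0) (at 0)"
      by (rule has_field_derivative_transform_within_open[OF DERIV_const open_ball[of 0 e]])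
        (use \<gamma>(1) const in auto)
    moreover have "(?f has_field_derivative (\<Sum>l<?n. \<Sum>k<?n.
        X $$ (k, i) * ?T $$ (k, l) * \<gamma> 0 $$ (l, j) + \<gamma> 0 $$ (k, i) * ?T $$ (k, l) * X $$ (l, j))) (at 0)"
    proof (intro DERIV_sum)
      fix k l assume "k \<in> {..<?n}" "l \<in> {..<?n}"
      then have "((\<lambda>t. \<gamma> t $$ (k, i)) has_field_derivative X $$ (k, i)) (at 0)"
        "((\<lambda>t. \<gamma> t $$ (l, j)) has_field_derivative X $$ (l, j)) (at 0)"
        using ij by (auto intro: \<gamma>(4))
      then show "((\<lambda>t. \<gamma> t $$ (k, i) * ?T $$ (k, l) * \<gamma> t $$ (l, j)) has_field_derivative
          X $$ (k, i) * ?T $$ (k, l) * \<gamma> 0 $$ (l, j) + \<gamma> 0 $$ (k, i) * ?T $$ (k, l) * X $$ (l, j)) (at 0)"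
        by (auto intro!: derivative_eq_intros)
    qed
    ultimately have "0 = (\<Sum>l<?n. \<Sum>k<?n.
        X $$ (k, i) * ?T $$ (k, l) * \<gamma> 0 $$ (l, j) + \<gamma> 0 $$ (k, i) * ?T $$ (k, l) * X $$ (l, j))"
      by (rule DERIV_unique)
    also have "\<dots> = (transpose_mat X * ?T * 1\<^sub>m ?n) $$ (i, j) + (transpose_mat (1\<^sub>m ?n) * ?T * X) $$ (i, j)"
      unfolding index_form[OF T X one_carrier_mat ij] index_form[OF T one_carrier_mat X ij] \<gamma>(2) sum.distrib ..
    also have "\<dots> = (transpose_mat X * ?T + ?T * X) $$ (i, j)"
      using X T ij by (simp del: index_mult_mat(1) assoc_mult_mat)
    finally show ?thesis by simp
  qed
  with X show "X \<in> ralg p"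
    by (auto simp: ralg_def mat_eq_iff simp del: index_mult_mat(1) index_add_mat(1))
next
  let ?n = "2 * p"
  note T = Theta_carrier[of p, where 'k = complex]
  have G: "(Rgrp p :: complex mat set) \<subseteq> carrier_mat ?n ?n"
    by (auto simp: Rgrp_iff)
  fix X :: "complex mat"
  assume "X \<in> ralg p"
  then show "X \<in> complex_lie_algebra ?n (Rgrp p)"
  proof (induction rule: ralg_transvection_induct)
    case zero
    have "1\<^sub>m ?n + t \<cdot>\<^sub>m 0\<^sub>m ?n ?n \<in> (Rgrp p :: complex mat set)" for t
      using T by (simp add: Rgrp_iff)
    then show ?case
      by (intro complex_lie_algebra_line) auto
  next
    case (add X Y)
    then show ?case
      by (intro complex_lie_algebra_add[OF G Rgrp_mult])
  next
    case (transvection c V)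
    have VV: "V * transpose_mat V \<in> carrier_mat ?n ?n"
      using transvection by auto
    show ?case
    proof (rule complex_lie_algebra_line)
      show "c \<cdot>\<^sub>m (V * transpose_mat V) * Theta p \<in> carrier_mat ?n ?n"
        by (rule mult_carrier_mat[OF smult_carrier_mat[OF VV] T])
      show "1\<^sub>m ?n + t \<cdot>\<^sub>m (c \<cdot>\<^sub>m (V * transpose_mat V) * Theta p) \<in> Rgrp p" for t
        using transvection_in_Rgrp[OF transvection, of "t * c"] by (simp add: smult_transvection[OF VV T])
    qed
  qed
qed

section \<open>The symplectic group as a complex submanifold\<close>

text \<open>
  The differential at \<open>B\<close> of the entry \<open>(i, j)\<close> of \<open>B\<^sup>T \<Theta> B\<close>, as its matrix of partial
  derivatives.
\<close>

definition isometry_differential :: "nat \<Rightarrow> complex mat \<Rightarrow> nat \<Rightarrow> nat \<Rightarrow> complex mat" where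
  "isometry_differential p B i j = Matrix.mat (2 * p) (2 * p) (\<lambda>(a, b).
     (if b = i then (Theta p * B) $$ (a, j) else 0) +
     (if b = j then (transpose_mat B * Theta p) $$ (i, a) else 0))"

lemma isometry_differential_apply:
  assumes B: "B \<in> carrier_mat (2 * p) (2 * p)" and H: "H \<in> carrier_mat (2 * p) (2 * p)"
    and ij: "i < 2 * p" "j < 2 * p"
  shows "(\<Sum>v \<in> {..<2 * p} \<times> {..<2 * p}. isometry_differential p B i j $$ v * H $$ v) =
    (transpose_mat H * Theta p * B + transpose_mat B * Theta p * H) $$ (i, j)"
proof -
  let ?n = "2 * p"
  note T = Theta_carrier[of p, where 'k = complex]
  have TB: "Theta p * B \<in> carrier_mat ?n ?n" and BT: "transpose_mat B * Theta p \<in> carrier_mat ?n ?n"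
    using B T by auto
  have "(transpose_mat H * Theta p * B) $$ (i, j) = (transpose_mat H * (Theta p * B)) $$ (i, j)"
    using B H T by (simp add: assoc_mult_square[of _ ?n])
  also have "\<dots> = (\<Sum>a<?n. H $$ (a, i) * (Theta p * B) $$ (a, j))"
    using H ij by (subst index_mult_mat_sum[OF _ TB]) auto
  finally have 1: "(transpose_mat H * Theta p * B) $$ (i, j) = (\<Sum>a<?n. H $$ (a, i) * (Theta p * B) $$ (a, j))" .
  have 2: "(transpose_mat B * Theta p * H) $$ (i, j) = (\<Sum>a<?n. (transpose_mat B * Theta p) $$ (i, a) * H $$ (a, j))"
    by (rule index_mult_mat_sum[OF BT H ij])
  have "(\<Sum>v \<in> {..<?n} \<times> {..<?n}. isometry_differential p B i j $$ v * H $$ v) =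
      (\<Sum>a<?n. \<Sum>b<?n. (if b = i then (Theta p * B) $$ (a, j) * H $$ (a, b) else 0)
        + (if b = j then (transpose_mat B * Theta p) $$ (i, a) * H $$ (a, b) else 0))"
    unfolding sum.cartesian_product
    by (rule sum.cong) (auto simp: isometry_differential_def distrib_right simp del: index_mult_mat(1))
  also have "\<dots> = (transpose_mat H * Theta p * B) $$ (i, j) + (transpose_mat B * Theta p * H) $$ (i, j)"
    unfolding 1 2 using ij by (simp add: sum.distrib mult.commute del: index_mult_mat(1))
  finally show ?thesis
    using B H T ij by (simp del: index_mult_mat(1) assoc_mult_mat)
qed

lemma norm_form_le:
  assumes "H \<in> carrier_mat (2 * p) (2 * p)" "\<And>a b. a < 2 * p \<Longrightarrow> b < 2 * p \<Longrightarrow> norm (H $$ (a, b)) \<le> d"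
    and "i < 2 * p" "j < 2 * p"
  shows "norm ((transpose_mat H * Theta p * H) $$ (i, j) :: complex)
    \<le> (\<Sum>l<2 * p. \<Sum>k<2 * p. norm (Theta p $$ (k, l) :: complex)) * d\<^sup>2"
proof -
  have d: "0 \<le> d"
    using assms(2)[of i i] assms(3) norm_ge_zero order_trans by blast
  have "norm (\<Sum>l<2 * p. \<Sum>k<2 * p. H $$ (k, i) * Theta p $$ (k, l) * H $$ (l, j))
      \<le> (\<Sum>l<2 * p. \<Sum>k<2 * p. norm (Theta p $$ (k, l) :: complex) * d\<^sup>2)"
  proof (intro sum_norm_le)
    fix k l assume kl: "k \<in> {..<2 * p}" "l \<in> {..<2 * p}"
    have "norm (H $$ (k, i)) * norm (H $$ (l, j)) \<le> d * d"
      using assms kl d by (intro mult_mono) auto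
    then show "norm (H $$ (k, i) * Theta p $$ (k, l) * H $$ (l, j)) \<le> norm (Theta p $$ (k, l) :: complex) * d\<^sup>2"
      using mult_left_mono[of "norm (H $$ (k, i)) * norm (H $$ (l, j))" "d * d" "norm (Theta p $$ (k, l) :: complex)"]
      by (simp add: norm_mult power2_eq_square mult_ac)
  qed
  then show ?thesis
    unfolding index_form[OF Theta_carrier assms(1,1,3,4)] sum_distrib_right .
qed

text \<open>
  The remainder of the linear approximation is the quadratic term \<open>H\<^sup>T \<Theta> H\<close> of the expansion.
\<close>

lemma has_mat_derivative_isometry_equation:
  assumes B: "B \<in> carrier_mat (2 * p) (2 * p)" and ij: "i < 2 * p" "j < 2 * p"
  shows "has_mat_derivative (2 * p) (\<lambda>A. (transpose_mat A * Theta p * A) $$ (i, j) - Theta p $$ (i, j))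
    (isometry_differential p B i j) B"
  unfolding has_mat_derivative_def
proof (intro allI impI)
  let ?n = "2 * p"
  let ?T = "Theta p :: complex mat"
  note T = Theta_carrier[of p, where 'k = complex]
  fix \<epsilon> :: real assume \<epsilon>: "\<epsilon> > 0"
  define K where "K = (\<Sum>l<?n. \<Sum>k<?n. norm (?T $$ (k, l)))"
  have K: "K \<ge> 0"
    by (simp add: K_def sum_nonneg)
  have "norm ((transpose_mat A * ?T * A) $$ (i, j) - ?T $$ (i, j)
      - ((transpose_mat B * ?T * B) $$ (i, j) - ?T $$ (i, j))
      - (\<Sum>v \<in> {..<?n} \<times> {..<?n}. isometry_differential p B i j $$ v * (A $$ v - B $$ v)))
      \<le> \<epsilon> * mat_dist ?n A B"
    if A: "A \<in> carrier_mat ?n ?n" and small: "mat_dist ?n A B < \<epsilon> / (K + 1)" for A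
  proof -
    let ?H = "A - B"
    let ?d = "mat_dist ?n A B"
    have H: "?H \<in> carrier_mat ?n ?n"
      by (rule minus_carrier_mat[OF B])
    have "A = B + ?H"
      using A B by (intro eq_matI) auto
    then have "transpose_mat A * ?T * A =
        transpose_mat B * ?T * B + (transpose_mat ?H * ?T * B + transpose_mat B * ?T * ?H)
        + transpose_mat ?H * ?T * ?H"
      using form_expand[OF T B H] by simp
    then have "(transpose_mat A * ?T * A) $$ (i, j) = (transpose_mat B * ?T * B) $$ (i, j)
        + (transpose_mat ?H * ?T * B + transpose_mat B * ?T * ?H) $$ (i, j) + (transpose_mat ?H * ?T * ?H) $$ (i, j)"
      using B H T ij by (simp del: index_mult_mat(1) assoc_mult_mat)
    moreover have "(\<Sum>v \<in> {..<?n} \<times> {..<?n}. isometry_differential p B i j $$ v * (A $$ v - B $$ v)) =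
        (transpose_mat ?H * ?T * B + transpose_mat B * ?T * ?H) $$ (i, j)"
      unfolding isometry_differential_apply[OF B H ij, symmetric]
      using A B by (intro sum.cong) auto
    moreover have "norm ((transpose_mat ?H * ?T * ?H) $$ (i, j)) \<le> K * ?d\<^sup>2"
      unfolding K_def
    proof (rule norm_form_le[OF H _ ij])
      fix a b assume "a < ?n" "b < ?n"
      then show "norm (?H $$ (a, b)) \<le> ?d"
        unfolding mat_dist_def using A B
          member_le_sum[of "(a, b)" "{..<?n} \<times> {..<?n}" "\<lambda>v. norm (A $$ v - B $$ v)"] by auto
    qed
    moreover have "K * ?d\<^sup>2 \<le> \<epsilon> * ?d"
    proof -
      have d: "?d \<ge> 0"
        by (simp add: mat_dist_def sum_nonneg)
      have "K * ?d \<le> (K + 1) * ?d"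
        using d by (simp add: mult_right_mono)
      also have "\<dots> \<le> \<epsilon>"
        using small K by (simp add: field_simps)
      finally show ?thesis
        using d by (simp add: power2_eq_square mult_right_mono flip: mult.assoc)
    qed
    ultimately show ?thesis
      by simp
  qed
  moreover have "\<epsilon> / (K + 1) > 0"
    using \<epsilon> K by simp
  ultimately show "\<exists>\<delta>>0. \<forall>A \<in> carrier_mat ?n ?n. mat_dist ?n A B < \<delta> \<longrightarrow>
      norm ((transpose_mat A * ?T * A) $$ (i, j) - ?T $$ (i, j)
      - ((transpose_mat B * ?T * B) $$ (i, j) - ?T $$ (i, j))
      - (\<Sum>v \<in> {..<?n} \<times> {..<?n}. isometry_differential p B i j $$ v * (A $$ v - B $$ v)))
      \<le> \<epsilon> * mat_dist ?n A B"
    by blast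
qed

text \<open>
  Both sides of \<open>A\<^sup>T \<Theta> A = \<Theta>\<close> are skew-symmetric, so only the entries above the diagonal are
  genuine equations. This removes the redundancy that would make the differentials linearly
  dependent.
\<close>

lemma Rgrp_iff_upper_entries:
  fixes A :: "'k::field_char_0 mat"
  assumes A: "A \<in> carrier_mat (2 * p) (2 * p)"
  shows "A \<in> Rgrp p \<longleftrightarrow>
    (\<forall>i j. i < j \<and> j < 2 * p \<longrightarrow> (transpose_mat A * Theta p * A) $$ (i, j) = Theta p $$ (i, j))"
proof
  let ?n = "2 * p"
  let ?T = "Theta p :: 'k mat"
  note T = Theta_carrier[of p, where 'k = 'k]
  define M where "M = transpose_mat A * ?T * A"
  assume upper: "\<forall>i j. i < j \<and> j < ?n \<longrightarrow> (transpose_mat A * ?T * A) $$ (i, j) = ?T $$ (i, j)"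
  have M: "M \<in> carrier_mat ?n ?n"
    using A T by (simp add: M_def)
  have skew: "N $$ (j, i) = - N $$ (i, j)"
    if "N \<in> carrier_mat ?n ?n" "transpose_mat N = - N" "i < ?n" "j < ?n" for N :: "'k mat" and i j
  proof -
    have "transpose_mat N $$ (i, j) = (- N) $$ (i, j)"
      by (simp only: that(2))
    then show ?thesis
      using that(1,3,4) by auto
  qed
  have skewM: "transpose_mat M = - M"
    unfolding M_def using transpose_form[OF T transpose_Theta A A] .
  have "M = ?T"
  proof (rule eq_matI)
    fix i j assume "i < dim_row ?T" "j < dim_col ?T"
    then have ij: "i < ?n" "j < ?n"
      by auto
    consider "i < j" | "j < i" | "i = j"
      by linarith
    then show "M $$ (i, j) = ?T $$ (i, j)"
    proof cases
      case 1
      then show ?thesis using upper ij by (simp add: M_def)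
    next
      case 2
      then have "M $$ (j, i) = ?T $$ (j, i)"
        using upper ij by (simp add: M_def)
      then show ?thesis
        using skew[OF M skewM ij] skew[OF T transpose_Theta ij] by simp
    next
      case 3
      then show ?thesis
        using skew[OF M skewM ij] skew[OF T transpose_Theta ij] by simp
    qed
  qed (use M in auto)
  then show "A \<in> Rgrp p"
    using A by (simp add: Rgrp_iff M_def)
qed (auto simp: Rgrp_iff)

text \<open>
  A right inverse of the differential, onto the skew-symmetric matrices: \<open>H = - A \<Theta> C / 2\<close>
  satisfies \<open>A\<^sup>T \<Theta> H = - \<Theta>\<^sup>2 C / 2 = C / 2\<close>, and \<open>H\<^sup>T \<Theta> A\<close>, minus the transpose of this
  matrix, is \<open>C / 2\<close> as well.
\<close>

lemma isometry_differential_surj: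
  fixes A :: "'k::field_char_0 mat"
  assumes "A \<in> Rgrp p" and C: "C \<in> carrier_mat (2 * p) (2 * p)" and skew: "transpose_mat C = - C"
  obtains H where "H \<in> carrier_mat (2 * p) (2 * p)"
    "transpose_mat H * Theta p * A + transpose_mat A * Theta p * H = C"
proof
  let ?n = "2 * p"
  let ?T = "Theta p :: 'k mat"
  note T = Theta_carrier[of p, where 'k = 'k]
  note sq = assoc_mult_square[of _ ?n] mult_carrier_mat[where nr = ?n and n = ?n and nc = ?n]
  have A: "A \<in> carrier_mat ?n ?n" and eq: "transpose_mat A * ?T * A = ?T"
    using assms(1) by (auto simp: Rgrp_iff)
  define H where "H = (- 1 / 2) \<cdot>\<^sub>m (A * (?T * C))"
  have ATC: "A * (?T * C) \<in> carrier_mat ?n ?n" and AtT: "transpose_mat A * ?T \<in> carrier_mat ?n ?n"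
    using A T C by (auto simp: sq)
  show H: "H \<in> carrier_mat ?n ?n"
    using ATC by (simp add: H_def)
  have "transpose_mat A * ?T * (A * (?T * C)) = (transpose_mat A * ?T * A) * (?T * C)"
    using A T C by (simp add: sq)
  also have "\<dots> = (?T * ?T) * C"
    unfolding eq using T C by (simp add: sq)
  also have "\<dots> = - C"
    unfolding Theta_squared using C by simp
  finally have half: "transpose_mat A * ?T * H = (1 / 2) \<cdot>\<^sub>m C"
    unfolding H_def mult_smult_distrib[OF AtT ATC] using C by (intro eq_matI) auto
  have "transpose_mat H * ?T * A = - transpose_mat (transpose_mat A * ?T * H)"
    unfolding transpose_form[OF T transpose_Theta A H] by simp
  also have "\<dots> = - ((1 / 2) \<cdot>\<^sub>m transpose_mat C)"
    unfolding half using C by (intro eq_matI) auto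
  also have "\<dots> = (1 / 2) \<cdot>\<^sub>m C"
    unfolding skew using C by (intro eq_matI) auto
  finally show "transpose_mat H * ?T * A + transpose_mat A * ?T * H = C"
    unfolding half using C by (intro eq_matI) auto
qed

text \<open>
  The group is the regular zero set of the \<open>p (2 p - 1)\<close> entries of \<open>A\<^sup>T \<Theta> A - \<Theta>\<close> above the
  diagonal, with the same equations near every point; \<open>\<pi>\<close> numbers the positions.
\<close>

lemma complex_submanifold_Rgrp: "complex_submanifold (2 * p) (Rgrp p)"
proof -
  let ?n = "2 * p"
  let ?P = "{(i, j). i < j \<and> j < ?n}"
  have fin: "finite ?P"
    by (rule finite_subset[of _ "{..<?n} \<times> {..<?n}"]) auto
  obtain \<pi> where "bij_betw \<pi> {..<card ?P} ?P"
    using ex_bij_betw_nat_finite[OF fin] unfolding atLeast0LessThan by (elim exE) (rule that)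
  then obtain m where \<pi>: "bij_betw \<pi> {..<m} ?P"
    by blast
  have \<pi>_bounds: "fst (\<pi> k) < snd (\<pi> k)" "fst (\<pi> k) < ?n" "snd (\<pi> k) < ?n" if "k < m" for k
  proof -
    have "\<pi> k \<in> ?P"
      by (rule bij_betw_apply[OF \<pi>]) (use that in simp)
    then show "fst (\<pi> k) < snd (\<pi> k)" "fst (\<pi> k) < ?n" "snd (\<pi> k) < ?n"
      by auto
  qed
  define F where "F = (\<lambda>k A. (transpose_mat A * Theta p * A) $$ (fst (\<pi> k), snd (\<pi> k))
    - Theta p $$ (fst (\<pi> k), snd (\<pi> k)) :: complex)"
  define D where "D = (\<lambda>k A. isometry_differential p A (fst (\<pi> k)) (snd (\<pi> k)))"
  have equations: "B \<in> Rgrp p \<longleftrightarrow> (\<forall>k<m. F k B = 0)"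
    if B: "B \<in> carrier_mat ?n ?n" for B
  proof -
    have "(\<forall>k<m. F k B = 0) \<longleftrightarrow>
        (\<forall>v\<in>?P. (transpose_mat B * Theta p * B) $$ (fst v, snd v) = Theta p $$ (fst v, snd v))"
      unfolding bij_betw_imp_surj_on[OF \<pi>, symmetric] by (auto simp: F_def)
    then show ?thesis
      unfolding Rgrp_iff_upper_entries[OF B] by (auto simp del: assoc_mult_mat)
  qed
  have derivative: "has_mat_derivative ?n (F k) (D k B) B"
    if "k < m" "B \<in> carrier_mat ?n ?n" for k B
    unfolding F_def D_def using has_mat_derivative_isometry_equation \<pi>_bounds that by blast
  have independent: "\<exists>H \<in> carrier_mat ?n ?n. \<forall>k<m.
      (\<Sum>v \<in> {..<?n} \<times> {..<?n}. D k A $$ v * H $$ v) = c k" if A: "A \<in> Rgrp p" for A c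
  proof -
    define g where "g = c \<circ> the_inv_into {..<m} \<pi>"
    have g: "g (\<pi> k) = c k" if "k < m" for k
      using the_inv_into_f_f[OF bij_betw_imp_inj_on[OF \<pi>], of k] that by (simp add: g_def)
    define C where "C = Matrix.mat ?n ?n
      (\<lambda>(i, j). if i < j then g (i, j) else if j < i then - g (j, i) else 0)"
    have "transpose_mat C = - C"
      by (rule eq_matI) (auto simp: C_def)
    then obtain H where H: "H \<in> carrier_mat ?n ?n"
      and eq: "transpose_mat H * Theta p * A + transpose_mat A * Theta p * H = C"
      using isometry_differential_surj[OF A, of C] by (auto simp: C_def)
    have "(\<Sum>v \<in> {..<?n} \<times> {..<?n}. D k A $$ v * H $$ v) = c k" if k: "k < m" for k
    proof -
      have "(\<Sum>v \<in> {..<?n} \<times> {..<?n}. D k A $$ v * H $$ v) = C $$ (fst (\<pi> k), snd (\<pi> k))"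
        unfolding D_def eq[symmetric] using A H \<pi>_bounds[OF k]
        by (intro isometry_differential_apply) (auto simp: Rgrp_iff)
      also have "\<dots> = c k"
        using \<pi>_bounds[OF k] g[OF k] by (cases "\<pi> k") (simp add: C_def)
      finally show ?thesis .
    qed
    with H show ?thesis
      by blast
  qed
  show ?thesis
    unfolding complex_submanifold_def
  proof (intro conjI exI[of _ "m"] ballI)
    show "Rgrp p \<subseteq> carrier_mat ?n ?n"
      by (auto simp: Rgrp_iff)
    fix A :: "complex mat" assume A: "A \<in> Rgrp p"
    show "\<exists>r>0. \<exists>F D. (\<forall>B \<in> carrier_mat ?n ?n. mat_dist ?n B A < r \<longrightarrow>
           (B \<in> Rgrp p \<longleftrightarrow> (\<forall>k<m. F k B = 0)) \<and>
           (\<forall>k<m. has_mat_derivative ?n (F k) (D k B) B)) \<and>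
        (\<forall>c. \<exists>H \<in> carrier_mat ?n ?n. \<forall>k<m.
           (\<Sum>v \<in> {..<?n} \<times> {..<?n}. D k A $$ v * H $$ v) = c k)"
    proof (rule exI[of _ "1::real"], intro conjI exI[of _ F] exI[of _ D] ballI impI allI)
      show "\<exists>H \<in> carrier_mat ?n ?n. \<forall>k<m.
          (\<Sum>v \<in> {..<?n} \<times> {..<?n}. D k A $$ v * H $$ v) = c k" for c
        by (rule independent[OF A])
    qed (simp_all only: equations derivative zero_less_one)
  qed
qed

theorem proposition22:
  fixes p :: nat
  assumes "p \<ge> 1"
  shows "(linear_algebraic_subgroup (2 * p) (Rgrp p :: 'k::{alg_closed_field, field_char_0} mat set) \<and>
          lie_subalgebra (2 * p) (ralg p :: 'k mat set) \<and>
          algebraic_lie_algebra (2 * p) (Rgrp p :: 'k mat set) = ralg p) \<and>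
         (complex_lie_subgroup (2 * p) (Rgrp p) \<and>
          complex_lie_algebra (2 * p) (Rgrp p) = ralg p)"
  using linear_algebraic_subgroup_Rgrp lie_subalgebra_ralg algebraic_lie_algebra_Rgrp
    subgroup_Rgrp complex_submanifold_Rgrp complex_lie_algebra_Rgrp
  unfolding complex_lie_subgroup_def by blast

end
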